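(* For every positive integer $n$, $$\max\{d_{-}(\pi) \mid \pi\in S_n\}= \lfloor n^2/4 \rfloor .$$
   Context: $S_n$ is the symmetric group on $\{1,\dots,n\}$; a permutation $\pi$ is written as its sequence of values $[\pi(1),\dots,\pi(n)]$. For $1\le a<b\le n$, $t_{a,b}\in S_n$ is the transposition interchanging $a$ and $b$; $t_{a,b}\pi$ is obtained from $\pi$ by interchanging the values $a$ and $b$. The length $\ell(\pi)$ is the minimal $k$ such that $\pi$ is a product of $k$ adjacent transpositions $s_i=t_{i,i+1}$ ($1\le i<n$). The down degree of $\pi$ is the number of permutations covered by $\pi$ in the strong Bruhat order on $S_n$; equivalently $d_{-}(\pi)=\#\{t_{a,b} \mid 1\le a<b\le n,\ \ell(t_{a,b}\pi)=\ell(\pi)-1\}$. *)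

theory Defs
  imports "HOL-Combinatorics.Permutations"
begin

(* Elements of S_n are functions p with "p permutes {1..n}"; Transposition.transpose a b is t_{a,b},
   and since products compose right to left, "transpose a b \<circ> p" swaps the values a and b of p. *)

definition perm_length :: "nat \<Rightarrow> (nat \<Rightarrow> nat) \<Rightarrow> nat" where
  "perm_length n p =
     (LEAST k. \<exists>js. length js = k \<and> set js \<subseteq> {1..<n} \<and>
        p = foldr (\<lambda>j q. transpose j (j + 1) \<circ> q) js id)"

definition bruhat_step :: "nat \<Rightarrow> (nat \<Rightarrow> nat) \<Rightarrow> (nat \<Rightarrow> nat) \<Rightarrow> bool" where
  "bruhat_step n q p \<longleftrightarrow>
     p permutes {1..n} \<and>
     (\<exists>a b. 1 \<le> a \<and> a < b \<and> b \<le> n \<and> q = transpose a b \<circ> p) \<and>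
     perm_length n q < perm_length n p"

definition bruhat_le :: "nat \<Rightarrow> (nat \<Rightarrow> nat) \<Rightarrow> (nat \<Rightarrow> nat) \<Rightarrow> bool" where
  "bruhat_le n = (bruhat_step n)\<^sup>*\<^sup>*"

definition bruhat_less :: "nat \<Rightarrow> (nat \<Rightarrow> nat) \<Rightarrow> (nat \<Rightarrow> nat) \<Rightarrow> bool" where
  "bruhat_less n q p \<longleftrightarrow> bruhat_le n q p \<and> q \<noteq> p"

definition bruhat_covers :: "nat \<Rightarrow> (nat \<Rightarrow> nat) \<Rightarrow> (nat \<Rightarrow> nat) \<Rightarrow> bool" where
  "bruhat_covers n p q \<longleftrightarrow>
     bruhat_less n q p \<and>
     \<not> (\<exists>r. r permutes {1..n} \<and> bruhat_less n q r \<and> bruhat_less n r p)"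

(* The number of permutations covered by p; this is also the number of transpositions t_{a,b}
   with perm_length n (transpose a b \<circ> p) = perm_length n p - 1, because the strong
   Bruhat order is graded by length. *)
definition down_degree :: "nat \<Rightarrow> (nat \<Rightarrow> nat) \<Rightarrow> nat" where
  "down_degree n p = card {q. q permutes {1..n} \<and> bruhat_covers n p q}"

end

theory Submission
  imports Defs
begin

text \<open>
  Writing permutations by positions, the permutations covered by \<open>p\<close> are exactly the
  \<open>p \<circ> transpose i j\<close> where \<open>(i, j)\<close> is a minimal inversion: \<open>i < j\<close>, \<open>p i > p j\<close>, and no
  entry between these two positions has a value between these two values
  (\<open>bruhat_covers_iff\<close>). So the down degree counts the minimal inversions.

  The minimal inversions are the edges of a graph on the \<open>n\<close> positions, and this graph has no
  triangle: if \<open>i < j < k\<close> were pairwise inversions, then the entry at \<open>j\<close> would lie between the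
  other two in position and in value, and \<open>(i, k)\<close> would not be minimal. Mantel's theorem bounds
  the number of edges by \<open>\<lfloor>n\<^sup>2 / 4\<rfloor>\<close>. Equality holds for a complete bipartite
  graph with balanced parts, and this is the graph of \<open>[m + 1, \<dots>, n, 1, \<dots>, m]\<close> with
  \<open>m = \<lfloor>n / 2\<rfloor>\<close>: each of its two blocks is increasing, so every pair with one position
  in each block is a minimal inversion.

  The description of the covers rests on two facts. By the exchange property
  (\<open>word_exchange\<close>), swapping an inversion shortens a permutation, so the steps that generate
  the Bruhat order are exactly the swaps of inversions. And such a swap lowers the number of
  inversions, by exactly one when the inversion is minimal, so that nothing fits in between.
\<close>

section \<open>Words in the adjacent transpositions\<close>

primrec word :: "nat list \<Rightarrow> nat \<Rightarrow> nat" where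
  "word [] = id"
| "word (j # js) = transpose j (Suc j) \<circ> word js"

lemma perm_length_eq_Least_word:
  "perm_length n p = (LEAST k. \<exists>js. length js = k \<and> set js \<subseteq> {1..<n} \<and> p = word js)"
proof -
  have "foldr (\<lambda>j q. transpose j (j + 1) \<circ> q) js id = word js" for js
    by (induction js) simp_all
  then show ?thesis by (simp only: perm_length_def)
qed

lemma word_append: "word (js @ ks) = word js \<circ> word ks"
  by (induction js) (simp_all add: o_assoc)

lemma inj_word: "inj (word js)"
proof (induction js)
  case (Cons j js)
  then show ?case
    unfolding word.simps by (intro inj_compose inj_transpose)
qed simp

lemma comp_transpose:
  assumes "inj p"
  shows "p \<circ> transpose i j = transpose (p i) (p j) \<circ> p"
  using assms by (auto simp: fun_eq_iff transpose_def inj_eq)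

text \<open>
  The exchange property. In the word \<open>js\<close> read from right to left, there is a last letter \<open>j\<close>
  that brings the entries at the positions \<open>x\<close> and \<open>y\<close> from increasing to decreasing order. At
  that moment their values are \<open>j\<close> and \<open>j + 1\<close>, so deleting this letter has the effect of
  swapping the two entries.
\<close>
lemma word_exchange:
  assumes "x < y" "word js y < word js x"
  shows "\<exists>ks. length ks < length js \<and> set ks \<subseteq> set js \<and> word js \<circ> transpose x y = word ks"
  using assms
proof (induction js)
  case Nil
  then show ?case by simp
next
  case (Cons j js)
  show ?case
  proof (cases "word js y < word js x")
    case True
    then obtain ks where ks: "length ks < length js" "set ks \<subseteq> set js"
      "word js \<circ> transpose x y = word ks"
      using Cons by blast
    then have "word (j # js) \<circ> transpose x y = word (j # ks)"
      by (simp add: comp_assoc)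
    moreover have "length (j # ks) < length (j # js)" "set (j # ks) \<subseteq> set (j # js)"
      using ks by auto
    ultimately show ?thesis by blast
  next
    case False
    have "word js x \<noteq> word js y"
      using inj_word[of js] Cons.prems(1) by (auto dest: injD)
    with False have "word js x < word js y"
      by simp
    with Cons.prems(2) have "word js x = j" "word js y = Suc j"
      by (auto simp: transpose_def split: if_splits)
    then have "word js \<circ> transpose x y = transpose j (Suc j) \<circ> word js"
      using comp_transpose[OF inj_word, of js x y] by simp
    then have "word (j # js) \<circ> transpose x y = word js"
      by (simp add: comp_assoc) (simp add: o_assoc)
    moreover have "length js < length (j # js)" "set js \<subseteq> set (j # js)"
      by auto
    ultimately show ?thesis by blast
  qed
qed

lemma transpose_eq_word:
  assumes "1 \<le> a" "a < b" "b \<le> n"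
  shows "\<exists>js. set js \<subseteq> {1..<n} \<and> word js = transpose a b"
proof -
  have "Suc a \<le> b" using assms by simp
  then show ?thesis using assms(3)
  proof (induction b rule: dec_induct)
    case base
    then show ?case using assms(1) by (intro exI[of _ "[a]"]) auto
  next
    case (step b)
    then obtain js where js: "set js \<subseteq> {1..<n}" "word js = transpose a b"
      by auto
    \<comment> \<open>Conjugation by the adjacent transposition of \<open>b\<close> and \<open>b + 1\<close> moves \<open>b\<close> to \<open>b + 1\<close>.\<close>
    have "word (b # js @ [b]) = transpose b (Suc b) \<circ> (transpose a b \<circ> transpose b (Suc b))"
      using js(2) by (simp add: word_append)
    also have "\<dots> = transpose a (Suc b)"
      using step.hyps by (auto simp: fun_eq_iff transpose_def)
    finally show ?case
      using js(1) step assms(1) by (intro exI[of _ "b # js @ [b]"]) auto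
  qed
qed

text \<open>
  Without this, the \<open>LEAST\<close> in \<^const>\<open>perm_length\<close> could range over an empty set, and its
  value would say nothing about the permutation.
\<close>
lemma permutes_eq_word:
  assumes "p permutes {1..n}"
  shows "\<exists>js. set js \<subseteq> {1..<n} \<and> word js = p"
  using finite_atLeastAtMost assms
proof (induction p rule: permutes_rev_induct)
  case id
  show ?case by (intro exI[of _ "[]"]) simp
next
  case (swap a b p)
  then obtain js where js: "set js \<subseteq> {1..<n}" "word js = p" by auto
  have "\<exists>ks. set ks \<subseteq> {1..<n} \<and> word ks = transpose a b"
    using transpose_eq_word[of a b n] transpose_eq_word[of b a n] swap
    by (cases a b rule: linorder_cases) (auto simp: transpose_commute)
  then obtain ks where "set ks \<subseteq> {1..<n}" "word ks = transpose a b" by auto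
  with js show ?case by (intro exI[of _ "js @ ks"]) (simp add: word_append)
qed

section \<open>Bruhat covers\<close>

definition inversions :: "nat \<Rightarrow> (nat \<Rightarrow> nat) \<Rightarrow> (nat \<times> nat) set" where
  "inversions n p = {(i, j). 1 \<le> i \<and> i < j \<and> j \<le> n \<and> p j < p i}"

definition minimal_inversions :: "nat \<Rightarrow> (nat \<Rightarrow> nat) \<Rightarrow> (nat \<times> nat) set" where
  "minimal_inversions n p =
     {(i, j) \<in> inversions n p. \<forall>k. i < k \<and> k < j \<longrightarrow> p k < p j \<or> p i < p k}"

lemma finite_inversions [simp]: "finite (inversions n p)"
  by (rule finite_subset[of _ "{1..n} \<times> {1..n}"]) (auto simp: inversions_def)

lemma permutes_comp_transpose:
  fixes i j n :: nat
  assumes "p permutes {1..n}" "1 \<le> i" "i < j" "j \<le> n"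
  shows "p \<circ> transpose i j permutes {1..n}"
proof (rule permutes_compose[OF _ assms(1)])
  show "transpose i j permutes {1..n}"
    using assms by (intro permutes_swap_id) simp_all
qed

lemma perm_length_swap_less:
  assumes p: "p permutes {1..n}" and ij: "(i, j) \<in> inversions n p"
  shows "perm_length n (p \<circ> transpose i j) < perm_length n p"
proof -
  have "\<exists>k js. length js = k \<and> set js \<subseteq> {1..<n} \<and> p = word js"
    using permutes_eq_word[OF p] by metis
  then have "\<exists>js. length js = perm_length n p \<and> set js \<subseteq> {1..<n} \<and> p = word js"
    unfolding perm_length_eq_Least_word by (rule LeastI_ex)
  then obtain js where js: "length js = perm_length n p" "set js \<subseteq> {1..<n}" "p = word js"
    by blast
  from ij js(3) obtain ks where ks: "length ks < length js" "set ks \<subseteq> set js"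
    "p \<circ> transpose i j = word ks"
    using word_exchange[of i j js] by (auto simp: inversions_def)
  have "perm_length n (p \<circ> transpose i j) \<le> length ks"
    unfolding perm_length_eq_Least_word using ks js(2) by (intro Least_le) auto
  with ks(1) js(1) show ?thesis by simp
qed

text \<open>
  The condition on the length in \<^const>\<open>bruhat_step\<close> becomes a condition on a single pair of
  entries: swapping them shortens \<open>p\<close> if and only if they are out of order.
\<close>
lemma bruhat_step_iff:
  assumes p: "p permutes {1..n}"
  shows "bruhat_step n q p \<longleftrightarrow> (\<exists>(i, j) \<in> inversions n p. q = p \<circ> transpose i j)"
proof
  assume "bruhat_step n q p"
  then obtain a b where ab: "1 \<le> a" "a < b" "b \<le> n" "q = transpose a b \<circ> p"
    and less: "perm_length n q < perm_length n p"
    unfolding bruhat_step_def by blast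
  have "a \<in> p ` {1..n}" "b \<in> p ` {1..n}"
    using ab permutes_image[OF p] by auto
  then obtain x y where xy: "x \<in> {1..n}" "y \<in> {1..n}" "p x = a" "p y = b"
    by auto
  define i j where "i = min x y" and "j = max x y"
  have "x \<noteq> y" using xy ab by auto
  then have ij: "1 \<le> i" "i < j" "j \<le> n"
    using xy by (auto simp: i_def j_def)
  have q: "q = p \<circ> transpose i j"
    using comp_transpose[OF permutes_inj[OF p], of x y] ab xy
    by (auto simp: i_def j_def min_def max_def transpose_commute)
  have "p i \<noteq> p j"
    using ij permutes_inj[OF p] by (auto dest: injD)
  \<comment> \<open>If the two entries were in order, then they would form an inversion of \<^term>\<open>q\<close>,
      and swapping them back would shorten \<^term>\<open>q\<close> to \<^term>\<open>p\<close>.\<close>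
  moreover have "\<not> p i < p j"
  proof
    assume "p i < p j"
    then have "(i, j) \<in> inversions n q"
      using ij by (simp add: inversions_def q)
    moreover have "q permutes {1..n}"
      unfolding q using p ij by (rule permutes_comp_transpose)
    moreover have "q \<circ> transpose i j = p"
      unfolding q by (simp add: comp_assoc)
    ultimately show False
      using perm_length_swap_less less by fastforce
  qed
  ultimately have "(i, j) \<in> inversions n p"
    using ij by (simp add: inversions_def)
  with q show "\<exists>(i, j) \<in> inversions n p. q = p \<circ> transpose i j" by auto
next
  assume "\<exists>(i, j) \<in> inversions n p. q = p \<circ> transpose i j"
  then obtain i j where ij: "(i, j) \<in> inversions n p" and q: "q = p \<circ> transpose i j"
    by auto
  have "i \<in> {1..n}" "j \<in> {1..n}"
    using ij by (auto simp: inversions_def)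
  then have "p i \<in> {1..n}" "p j \<in> {1..n}"
    by (simp_all only: permutes_in_image[OF p])
  moreover have "q = transpose (p j) (p i) \<circ> p"
    using comp_transpose[OF permutes_inj[OF p]] q by (simp add: transpose_commute)
  moreover have "p j < p i" using ij by (simp add: inversions_def)
  ultimately show "bruhat_step n q p"
    unfolding bruhat_step_def using p perm_length_swap_less[OF p ij] q
    by (metis atLeastAtMost_iff)
qed

text \<open>
  The inversions of \<open>p \<circ> transpose i j\<close> are embedded into those of \<open>p\<close> other than \<open>(i, j)\<close>.
  Relabelling positions by the transposition carries the values of one permutation to those of
  the other, so it sends inversions to inversions whenever it keeps the order of the two
  positions. It reverses this order only for pairs \<open>(i, k)\<close> or \<open>(k, j)\<close> with \<open>i < k < j\<close> and for
  \<open>(i, j)\<close> itself, and such pairs are left fixed: there the swap can only destroy inversions.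
  Besides \<open>(i, j)\<close>, it destroys one only if the entry at \<open>k\<close> has a value between the two swapped
  values, so for a minimal inversion the embedding is onto.
\<close>
lemma
  assumes ij: "(i, j) \<in> inversions n p"
  shows card_inversions_swap_less: "card (inversions n (p \<circ> transpose i j)) < card (inversions n p)"
    and card_inversions_swap_minimal: "(i, j) \<in> minimal_inversions n p \<Longrightarrow>
      card (inversions n p) = Suc (card (inversions n (p \<circ> transpose i j)))"
proof -
  let ?t = "transpose i j" and ?q = "p \<circ> transpose i j"
  define f where "f = (\<lambda>(x, y). if ?t x < ?t y then (?t x, ?t y) else (x, y))"
  have ij': "1 \<le> i" "i < j" "j \<le> n" "p j < p i"
    using ij by (auto simp: inversions_def)
  have inj: "inj_on f (inversions n ?q)"
  proof (rule inj_onI)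
    fix u v assume "u \<in> inversions n ?q" "v \<in> inversions n ?q" "f u = f v"
    then show "u = v"
      by (cases u; cases v)
        (auto simp: f_def inversions_def transpose_eq_iff split: if_splits)
  qed
  have sub: "f ` inversions n ?q \<subseteq> inversions n p - {(i, j)}"
  proof (rule image_subsetI)
    fix u assume "u \<in> inversions n ?q"
    then obtain x y where xy: "u = (x, y)" "1 \<le> x" "x < y" "y \<le> n" "p (?t y) < p (?t x)"
      by (auto simp: inversions_def)
    show "f u \<in> inversions n p - {(i, j)}"
    proof (cases "?t x < ?t y")
      case True
      then have "1 \<le> ?t x" "?t y \<le> n" "(?t x, ?t y) \<noteq> (i, j)"
        using xy ij' by (auto simp: transpose_def split: if_splits)
      with True xy show ?thesis by (simp add: f_def inversions_def)
    next
      case False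
      then have "p y < p x" "(x, y) \<noteq> (i, j)"
        using xy ij' by (auto simp: transpose_def split: if_splits)
      with False xy show ?thesis by (simp add: f_def inversions_def)
    qed
  qed
  have card: "card (inversions n p) = Suc (card (inversions n p - {(i, j)}))"
    using card_Suc_Diff1[OF finite_inversions ij] by simp
  have "card (inversions n ?q) \<le> card (inversions n p - {(i, j)})"
    using card_inj_on_le[OF inj sub] by simp
  with card show "card (inversions n ?q) < card (inversions n p)" by simp
  assume min: "(i, j) \<in> minimal_inversions n p"
  have "inversions n p - {(i, j)} \<subseteq> f ` inversions n ?q"
  proof
    fix u assume "u \<in> inversions n p - {(i, j)}"
    then obtain x y where u: "u = (x, y)" "1 \<le> x" "x < y" "y \<le> n" "p y < p x" "(x, y) \<noteq> (i, j)"
      by (auto simp: inversions_def)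
    show "u \<in> f ` inversions n ?q"
    proof (cases "?t x < ?t y")
      case True
      then have "(?t x, ?t y) \<in> inversions n ?q"
        using u ij' by (auto simp: inversions_def transpose_def)
      moreover have "f (?t x, ?t y) = u" using u by (simp add: f_def)
      ultimately show ?thesis by (metis imageI)
    next
      case False
      have "i < x \<and> x < j \<longrightarrow> p x < p j \<or> p i < p x"
        and "i < y \<and> y < j \<longrightarrow> p y < p j \<or> p i < p y"
        using min by (auto simp: minimal_inversions_def)
      then have "u \<in> inversions n ?q"
        using False u ij'
        by (auto simp: inversions_def transpose_def split: if_splits)
      moreover have "f u = u" using False u by (simp add: f_def)
      ultimately show ?thesis by (metis imageI)
    qed
  qed
  with sub have "f ` inversions n ?q = inversions n p - {(i, j)}" by blast
  with card card_image[OF inj] show "card (inversions n p) = Suc (card (inversions n ?q))"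
    by simp
qed

lemma bruhat_step_permutes:
  assumes "bruhat_step n q p"
  shows "q permutes {1..n}"
proof -
  have p: "p permutes {1..n}" using assms by (simp add: bruhat_step_def)
  with assms obtain i j where "(i, j) \<in> inversions n p" "q = p \<circ> transpose i j"
    using bruhat_step_iff by blast
  with permutes_comp_transpose[OF p] show ?thesis
    by (simp add: inversions_def)
qed

lemma bruhat_less_card_inversions:
  assumes "bruhat_less n q p"
  shows "card (inversions n q) < card (inversions n p)"
proof -
  have step: "card (inversions n q) < card (inversions n p)" if "bruhat_step n q p" for q p
    using that card_inversions_swap_less bruhat_step_iff[of p n q]
    by (auto simp: bruhat_step_def)
  have "(bruhat_step n)\<^sup>+\<^sup>+ q p"
    using assms by (auto simp: bruhat_less_def bruhat_le_def rtranclp_into_tranclp1 dest: rtranclpD)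
  then show ?thesis
    by (induction rule: tranclp_induct) (use step in \<open>force+\<close>)
qed

lemma bruhat_step_less:
  assumes "bruhat_step n q p"
  shows "bruhat_less n q p"
proof -
  have "q \<noteq> p" using assms by (auto simp: bruhat_step_def)
  with assms show ?thesis by (simp add: bruhat_less_def bruhat_le_def r_into_rtranclp)
qed

lemma bruhat_less_trans:
  assumes "bruhat_less n q r" "bruhat_less n r p"
  shows "bruhat_less n q p"
proof -
  have "q \<noteq> p"
    using assms[THEN bruhat_less_card_inversions] by auto
  with assms show ?thesis
    by (auto simp: bruhat_less_def bruhat_le_def)
qed

text \<open>
  If an entry at \<open>k\<close> lies between the entries at \<open>i\<close> and \<open>j\<close> in position and in value, the three
  entries form the pattern \<open>321\<close> and the swap turns it into \<open>123\<close>. This can be done in three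
  steps, through \<open>231\<close> and \<open>132\<close>, so it is not a cover. Conversely, the swap of a minimal
  inversion lowers the number of inversions by one, which leaves no room for a third
  permutation.
\<close>
lemma bruhat_covers_iff:
  assumes p: "p permutes {1..n}"
  shows "bruhat_covers n p q \<longleftrightarrow> (\<exists>(i, j) \<in> minimal_inversions n p. q = p \<circ> transpose i j)"
proof
  assume cov: "bruhat_covers n p q"
  then have "(bruhat_step n)\<^sup>*\<^sup>* q p" "q \<noteq> p"
    by (auto simp: bruhat_covers_def bruhat_less_def bruhat_le_def)
  then obtain r where r: "(bruhat_step n)\<^sup>*\<^sup>* q r" "bruhat_step n r p"
    by (metis rtranclp.cases)
  then have "q = r"
    using cov bruhat_step_permutes[OF r(2)] bruhat_step_less[OF r(2)]
    by (auto simp: bruhat_covers_def bruhat_less_def bruhat_le_def)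
  then obtain i j where ij: "(i, j) \<in> inversions n p" and q: "q = p \<circ> transpose i j"
    using r(2) bruhat_step_iff[OF p] by auto
  \<comment> \<open>The intermediate permutations \<open>231\<close> and \<open>132\<close> are \<open>?r1\<close> and \<open>?r2\<close>.\<close>
  have "p k < p j \<or> p i < p k" if k: "i < k" "k < j" for k
  proof (rule ccontr)
    assume "\<not> (p k < p j \<or> p i < p k)"
    moreover have "p k \<noteq> p j" "p k \<noteq> p i"
      using k permutes_inj[OF p] by (auto dest: injD)
    ultimately have pk: "p j < p k" "p k < p i" by auto
    let ?r1 = "p \<circ> transpose i k"
    let ?r2 = "?r1 \<circ> transpose i j"
    have bounds: "1 \<le> i" "j \<le> n" using ij by (auto simp: inversions_def)
    have i1: "(i, k) \<in> inversions n p" and i2: "(i, j) \<in> inversions n ?r1"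
      and i3: "(k, j) \<in> inversions n ?r2"
      using k bounds pk by (auto simp: inversions_def transpose_def)
    have q': "q = ?r2 \<circ> transpose k j"
      using k unfolding q by (auto simp: fun_eq_iff transpose_def)
    have s1: "bruhat_step n ?r1 p"
      using i1 bruhat_step_iff[OF p] by auto
    note r1 = bruhat_step_permutes[OF s1]
    have s2: "bruhat_step n ?r2 ?r1"
      using i2 bruhat_step_iff[OF r1] by auto
    note r2 = bruhat_step_permutes[OF s2]
    have s3: "bruhat_step n q ?r2"
      using i3 q' bruhat_step_iff[OF r2] by auto
    have "bruhat_less n q ?r1"
      using bruhat_less_trans[OF bruhat_step_less[OF s3] bruhat_step_less[OF s2]] .
    with cov r1 bruhat_step_less[OF s1] show False
      by (auto simp: bruhat_covers_def)
  qed
  with ij q show "\<exists>(i, j) \<in> minimal_inversions n p. q = p \<circ> transpose i j"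
    by (auto simp: minimal_inversions_def)
next
  assume "\<exists>(i, j) \<in> minimal_inversions n p. q = p \<circ> transpose i j"
  then obtain i j where min: "(i, j) \<in> minimal_inversions n p" and q: "q = p \<circ> transpose i j"
    by auto
  then have ij: "(i, j) \<in> inversions n p" by (auto simp: minimal_inversions_def)
  have "bruhat_less n q p"
    using ij q bruhat_step_iff[OF p] by (auto intro: bruhat_step_less)
  moreover have False if "bruhat_less n q r" "bruhat_less n r p" for r
    using that[THEN bruhat_less_card_inversions] card_inversions_swap_minimal[OF ij min] q
    by simp
  ultimately show "bruhat_covers n p q"
    by (auto simp: bruhat_covers_def)
qed

lemma down_degree_eq_card_minimal_inversions:
  assumes p: "p permutes {1..n}"
  shows "down_degree n p = card (minimal_inversions n p)"
proof -
  let ?f = "\<lambda>(i, j). p \<circ> transpose i j"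
  have "{q. q permutes {1..n} \<and> bruhat_covers n p q} = ?f ` minimal_inversions n p"
  proof -
    have "p \<circ> transpose i j permutes {1..n}" if "(i, j) \<in> minimal_inversions n p" for i j
      using that permutes_comp_transpose[OF p, of i j]
      by (simp add: minimal_inversions_def inversions_def)
    then show ?thesis using bruhat_covers_iff[OF p] by fastforce
  qed
  moreover have "inj_on ?f (minimal_inversions n p)"
  proof (rule inj_onI, clarify)
    fix i j k l
    assume "(i, j) \<in> minimal_inversions n p" "(k, l) \<in> minimal_inversions n p"
      and eq: "p \<circ> transpose i j = p \<circ> transpose k l"
    then have less: "i < j" "k < l"
      by (auto simp: minimal_inversions_def inversions_def)
    have t: "transpose i j x = transpose k l x" for x
      using eq permutes_inj[OF p] by (auto simp: fun_eq_iff inj_eq)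
    show "i = k \<and> j = l"
      using t[of i] t[of j] less by (auto simp: transpose_def split: if_splits)
  qed
  ultimately show ?thesis
    by (simp add: down_degree_def card_image)
qed

section \<open>Triangle-free graphs\<close>

lemma mult_diff_le_square_div_4:
  fixes d n :: nat
  shows "(n - d) * d \<le> n\<^sup>2 div 4"
proof (cases "d \<le> n")
  case True
  then obtain c where n: "n = c + d" by (metis le_add_diff_inverse2)
  have "4 * (int c * int d) \<le> (int c + int d)\<^sup>2"
    using zero_le_power2[of "int c - int d"] by (simp add: power2_eq_square algebra_simps)
  then have "int (4 * (c * d)) \<le> int ((c + d)\<^sup>2)" by simp
  then have "4 * (c * d) \<le> (c + d)\<^sup>2" by (simp only: of_nat_le_iff)
  then show ?thesis using n by simp
qed simp

text \<open>
  Mantel's theorem. Let \<open>v\<close> be a vertex of maximal degree \<open>d\<close>. Two neighbours of \<open>v\<close> are never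
  adjacent, so every edge has an end among the \<open>card V - d\<close> vertices that are not neighbours of
  \<open>v\<close>, and each of these has at most \<open>d\<close> edges.
\<close>
lemma mantel:
  assumes V: "finite V"
    and edges: "\<And>e. e \<in> E \<Longrightarrow> \<exists>x\<in>V. \<exists>y\<in>V. e = {x, y}"
    and triangle_free: "\<And>x y z. {x, y} \<in> E \<Longrightarrow> {y, z} \<in> E \<Longrightarrow> {x, z} \<in> E \<Longrightarrow> False"
  shows "card E \<le> (card V)\<^sup>2 div 4"
proof (cases "V = {}")
  case True
  then have "E = {}" using edges by auto
  then show ?thesis by simp
next
  case False
  define N where "N v = {w \<in> V. {v, w} \<in> E}" for v
  have finN: "finite (N v)" for v using V by (simp add: N_def)
  define d where "d = Max ((\<lambda>v. card (N v)) ` V)"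
  have "d \<in> (\<lambda>v. card (N v)) ` V"
    unfolding d_def using V False by (intro Max_in) auto
  then obtain v where v: "v \<in> V" "card (N v) = d" by auto
  have deg: "card (N w) \<le> d" if "w \<in> V" for w
    unfolding d_def using V that by (intro Max_ge) auto
  let ?W = "V - N v"
  have "E \<subseteq> (\<Union>w\<in>?W. (\<lambda>u. {u, w}) ` N w)"
  proof
    fix e assume e: "e \<in> E"
    then obtain x y where xy: "x \<in> V" "y \<in> V" "e = {x, y}" using edges by blast
    then have "x \<notin> N v \<or> y \<notin> N v"
      using triangle_free[of v x y] e by (auto simp: N_def)
    then show "e \<in> (\<Union>w\<in>?W. (\<lambda>u. {u, w}) ` N w)"
    proof
      assume "x \<notin> N v"
      with xy e show ?thesis by (intro UN_I[of x]) (auto simp: N_def insert_commute)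
    next
      assume "y \<notin> N v"
      with xy e show ?thesis by (intro UN_I[of y]) (auto simp: N_def insert_commute)
    qed
  qed
  then have "card E \<le> card (\<Union>w\<in>?W. (\<lambda>u. {u, w}) ` N w)"
    using V finN by (intro card_mono) auto
  also have "\<dots> \<le> (\<Sum>w\<in>?W. card ((\<lambda>u. {u, w}) ` N w))"
    using V by (intro card_UN_le) auto
  also have "\<dots> \<le> (\<Sum>w\<in>?W. d)"
    using finN deg by (intro sum_mono) (meson DiffD1 card_image_le order_trans)
  also have "\<dots> = (card V - d) * d"
    using v finN[of v] by (simp add: card_Diff_subset N_def)
  also have "\<dots> \<le> (card V)\<^sup>2 div 4"
    by (rule mult_diff_le_square_div_4)
  finally show ?thesis .
qed

section \<open>The maximal down degree\<close>

lemma card_minimal_inversions_le: "card (minimal_inversions n p) \<le> n\<^sup>2 div 4"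
proof -
  let ?g = "\<lambda>(i, j). {i, j}"
  let ?M = "minimal_inversions n p"
  have less: "i < j" if "(i, j) \<in> ?M" for i j
    using that by (auto simp: minimal_inversions_def inversions_def)
  have chain: False if "(i, j) \<in> ?M" "(j, k) \<in> ?M" "(i, k) \<in> ?M" for i j k
  proof -
    have "i < j" "j < k" "p j < p i" "p k < p j"
      using that by (simp_all add: minimal_inversions_def inversions_def)
    moreover from this have "p j < p k \<or> p i < p j"
      using that(3) by (auto simp: minimal_inversions_def)
    ultimately show False by simp
  qed
  have "inj_on ?g ?M"
    by (rule inj_onI) (auto simp: doubleton_eq_iff dest!: less)
  then have "card ?M = card (?g ` ?M)" by (simp add: card_image)
  also have "\<dots> \<le> (card {1..n})\<^sup>2 div 4"
  proof (rule mantel)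
    fix e assume "e \<in> ?g ` ?M"
    then show "\<exists>x\<in>{1..n}. \<exists>y\<in>{1..n}. e = {x, y}"
      by (fastforce simp: minimal_inversions_def inversions_def)
  next
    have edge: "(x, y) \<in> ?M \<or> (y, x) \<in> ?M" if "{x, y} \<in> ?g ` ?M" for x y
      using that by (auto simp: doubleton_eq_iff)
    fix x y z assume "{x, y} \<in> ?g ` ?M" "{y, z} \<in> ?g ` ?M" "{x, z} \<in> ?g ` ?M"
    note edges = this[THEN edge]
    have cycle: False if "(i, j) \<in> ?M" "(j, k) \<in> ?M" "(k, i) \<in> ?M" for i j k
      using that[THEN less] by simp
    \<comment> \<open>Of the eight ways to direct the three edges, six form a chain and two a cycle.\<close>
    from edges show False
      by (elim disjE) (erule (2) chain cycle)+
  qed simp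
  finally show ?thesis by simp
qed

text \<open>
  The sequence \<open>[m + 1, \<dots>, n, 1, \<dots>, m]\<close>, extended by the identity outside \<open>{1..n}\<close>.
\<close>
definition block_swap :: "nat \<Rightarrow> nat \<Rightarrow> nat \<Rightarrow> nat" where
  "block_swap n m i = (if 1 \<le> i \<and> i \<le> n then if i \<le> n - m then i + m else i - (n - m) else i)"

lemma block_swap_permutes:
  assumes "m \<le> n"
  shows "block_swap n m permutes {1..n}"
proof (rule bij_imp_permutes)
  have "inj_on (block_swap n m) {1..n}"
    using assms by (auto simp: inj_on_def block_swap_def split: if_splits)
  moreover have "block_swap n m ` {1..n} \<subseteq> {1..n}"
    using assms by (auto simp: block_swap_def)
  ultimately show "bij_betw (block_swap n m) {1..n} {1..n}"
    by (simp add: bij_betw_def endo_inj_surj)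
qed (auto simp: block_swap_def)

lemma card_minimal_inversions_block_swap:
  assumes "m \<le> n"
  shows "(n - m) * m \<le> card (minimal_inversions n (block_swap n m))"
proof -
  have "{1..n - m} \<times> {n - m + 1..n} \<subseteq> minimal_inversions n (block_swap n m)"
    using assms by (auto simp: minimal_inversions_def inversions_def block_swap_def)
  moreover have "finite (minimal_inversions n (block_swap n m))"
    by (rule finite_subset[OF _ finite_inversions]) (auto simp: minimal_inversions_def)
  ultimately have "card ({1..n - m} \<times> {n - m + 1..n}) \<le> card (minimal_inversions n (block_swap n m))"
    by (intro card_mono)
  then show ?thesis using assms by (simp add: card_cartesian_product)
qed

theorem proposition2p1:
  fixes n :: nat
  assumes "n \<ge> 1"
  shows "Max {down_degree n p | p. p permutes {1..n}} = n\<^sup>2 div 4"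
proof (rule Max_eqI)
  have "{down_degree n p | p. p permutes {1..n}} = down_degree n ` {p. p permutes {1..n}}"
    by auto
  then show "finite {down_degree n p | p. p permutes {1..n}}"
    by (simp add: finite_permutations)
next
  fix k assume "k \<in> {down_degree n p | p. p permutes {1..n}}"
  then show "k \<le> n\<^sup>2 div 4"
    using down_degree_eq_card_minimal_inversions card_minimal_inversions_le by auto
next
  let ?m = "n div 2"
  have perm: "block_swap n ?m permutes {1..n}" by (intro block_swap_permutes) simp
  have "n\<^sup>2 div 4 = (n - ?m) * ?m"
    by (cases "even n") (auto elim!: evenE oddE simp: power2_eq_square algebra_simps)
  then have "down_degree n (block_swap n ?m) = n\<^sup>2 div 4"
    using card_minimal_inversions_block_swap[of ?m n] card_minimal_inversions_le[of n "block_swap n ?m"]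
      down_degree_eq_card_minimal_inversions[OF perm] by simp
  with perm show "n\<^sup>2 div 4 \<in> {down_degree n p | p. p permutes {1..n}}"
    by force
qed

end
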